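(* Let $d:E_d\to[0,\infty)$ be a floppy graph metric with vertex set $V_d$. If the subspace $[V_d]^2\setminus E_d$ of the pseudometric space $([V_d]^2,\ddot d)$ is not discrete, then for every family $(F_{xy})_{xy\in[V_d]^2\setminus E_d}$ of subsets of $\mathbb R$ each containing more than one element, there exists a function $r\in\prod_{xy\in[V_d]^2\setminus E_d}F_{xy}$ such that $d\cup r$ is not a (full) metric.
   Context: Notation: $[X]^2=\{A\subseteq X:|A|=2\}$; $xy$ denotes $\{x,y\}$. A graph is a set $E$ of 2-element sets with vertex set $\bigcup E$; connected means any two vertices are joined by a finite path of edges. For a function $d:E_d\to[0,\infty)$ on a connected graph $E_d$ with vertex set $V_d$: $\hat d(x,y)=\inf\{\sum_{i=1}^n d(x_{i-1}x_i): x_0=x,\ x_n=y,\ x_{i-1}x_i\in E_d\}$ (with $\hat d(x,x)=0$); $\check d(x,y)=\sup_{ab\in E_d}\max\{0,d(ab)-\hat d(a,x)-\hat d(y,b)\}$; and $\ddot d(xy,uv)=\min\{\hat d(x,u)+\hat d(y,v),\hat d(x,v)+\hat d(y,u)\}$ for $xy,uv\in[V_d]^2$. A graph pseudometric is such a $d$ with $d(xy)=\hat d(x,y)$ for all $xy\in E_d$; a graph metric additionally has $d(xy)>0$ on $E_d$; it is floppy if $\check d(x,y)<\hat d(x,y)$ whenever $xy\in[V_d]^2\setminus E_d$. A full metric is a graph metric defined on all of $[V_d]^2$ (equivalently, a metric on $V_d$). A subspace $S$ of a pseudometric space is discrete if each $s\in S$ has $\varepsilon>0$ with no other point of $S$ within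 distance $<\varepsilon$ of $s$. The function $d\cup r$ is defined on $[V_d]^2$, equal to $d$ on $E_d$ and to $r$ elsewhere. *)

theory Defs
  imports Complex_Main "HOL-Library.FuncSet"
begin

text \<open>
  A partial function \<open>d : E \<rightarrow> [0,\<infinity>)\<close> is modelled by the edge set \<open>E\<close> together with
  a total function \<open>d :: 'a set \<Rightarrow> real\<close> whose values outside \<open>E\<close> play no role.
  The vertex set of \<open>E\<close> is \<open>\<Union>E\<close>.
\<close>

definition pairs :: "'a set \<Rightarrow> 'a set set" where
  "pairs X = {A. A \<subseteq> X \<and> card A = 2}"

definition simple_graph :: "'a set set \<Rightarrow> bool" where
  "simple_graph E \<longleftrightarrow> (\<forall>e\<in>E. card e = 2)"

text \<open>A path \<open>p 0, \<dots>, p n\<close>; the trivial path \<open>n = 0\<close> is allowed.\<close>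

definition graph_path :: "'a set set \<Rightarrow> 'a \<Rightarrow> 'a \<Rightarrow> nat \<Rightarrow> (nat \<Rightarrow> 'a) \<Rightarrow> bool" where
  "graph_path E x y n p \<longleftrightarrow> p 0 = x \<and> p n = y \<and> (\<forall>i\<in>{1..n}. {p (i - 1), p i} \<in> E)"

definition connected_graph :: "'a set set \<Rightarrow> bool" where
  "connected_graph E \<longleftrightarrow> simple_graph E \<and> (\<forall>x\<in>\<Union>E. \<forall>y\<in>\<Union>E. \<exists>n p. graph_path E x y n p)"

text \<open>For nonnegative \<open>d\<close> the trivial path makes \<open>hat_dist E d x x = 0\<close>.\<close>

definition hat_dist :: "'a set set \<Rightarrow> ('a set \<Rightarrow> real) \<Rightarrow> 'a \<Rightarrow> 'a \<Rightarrow> real" where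
  "hat_dist E d x y = Inf {(\<Sum>i=1..n. d {p (i - 1), p i}) | n p. graph_path E x y n p}"

text \<open>
  The supremum ranges over both orderings \<open>(a, b)\<close> of every edge. For a graph pseudometric and
  vertices \<open>x\<close>, \<open>y\<close> the set is bounded above by \<open>hat_dist E d x y\<close>, so the real supremum is
  the intended one.
\<close>

definition check_dist :: "'a set set \<Rightarrow> ('a set \<Rightarrow> real) \<Rightarrow> 'a \<Rightarrow> 'a \<Rightarrow> real" where
  "check_dist E d x y =
     Sup {max 0 (d {a, b} - hat_dist E d a x - hat_dist E d y b) | a b. {a, b} \<in> E}"

text \<open>
  Running over all ways of writing \<open>e = xy\<close> and \<open>f = uv\<close> yields exactly the two sums in the
  usual formula; see \<open>ddot_dist_pair\<close>.
\<close>

definition ddot_dist :: "'a set set \<Rightarrow> ('a set \<Rightarrow> real) \<Rightarrow> 'a set \<Rightarrow> 'a set \<Rightarrow> real" where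
  "ddot_dist E d e f =
     Min {hat_dist E d x u + hat_dist E d y v | x y u v. e = {x, y} \<and> f = {u, v}}"

lemma ddot_dist_pair:
  "ddot_dist E d {x, y} {u, v} =
     min (hat_dist E d x u + hat_dist E d y v) (hat_dist E d x v + hat_dist E d y u)"
proof -
  have "{hat_dist E d x' u' + hat_dist E d y' v' | x' y' u' v'. {x, y} = {x', y'} \<and> {u, v} = {u', v'}}
      = {hat_dist E d x u + hat_dist E d y v, hat_dist E d x v + hat_dist E d y u}"
    by (auto simp: doubleton_eq_iff add.commute)
  then show ?thesis
    by (simp add: ddot_dist_def)
qed

definition graph_pseudometric :: "'a set set \<Rightarrow> ('a set \<Rightarrow> real) \<Rightarrow> bool" where
  "graph_pseudometric E d \<longleftrightarrow> connected_graph E \<and> (\<forall>e\<in>E. 0 \<le> d e) \<and>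
     (\<forall>x y. {x, y} \<in> E \<longrightarrow> d {x, y} = hat_dist E d x y)"

definition graph_metric :: "'a set set \<Rightarrow> ('a set \<Rightarrow> real) \<Rightarrow> bool" where
  "graph_metric E d \<longleftrightarrow> graph_pseudometric E d \<and> (\<forall>e\<in>E. 0 < d e)"

definition floppy :: "'a set set \<Rightarrow> ('a set \<Rightarrow> real) \<Rightarrow> bool" where
  "floppy E d \<longleftrightarrow>
     (\<forall>x y. {x, y} \<in> pairs (\<Union>E) - E \<longrightarrow> check_dist E d x y < hat_dist E d x y)"

definition full_metric :: "'a set set \<Rightarrow> ('a set \<Rightarrow> real) \<Rightarrow> bool" where
  "full_metric E d \<longleftrightarrow> graph_metric E d \<and> E = pairs (\<Union>E)"

text \<open>
  In a pseudometric space, a point at distance \<open>0\<close> from \<open>s\<close> but different from \<open>s\<close>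
  also prevents \<open>s\<close> from being isolated.
\<close>

definition discrete_subspace :: "('b \<Rightarrow> 'b \<Rightarrow> real) \<Rightarrow> 'b set \<Rightarrow> bool" where
  "discrete_subspace \<rho> S \<longleftrightarrow> (\<forall>s\<in>S. \<exists>\<epsilon>>0. \<forall>t\<in>S. t \<noteq> s \<longrightarrow> \<not> \<rho> s t < \<epsilon>)"

definition extend_by :: "'a set set \<Rightarrow> ('a set \<Rightarrow> real) \<Rightarrow> ('a set \<Rightarrow> real) \<Rightarrow> 'a set \<Rightarrow> real" where
  "extend_by E d r = (\<lambda>e. if e \<in> E then d e else r e)"

end

theory Submission
  imports Defs
begin

text \<open>
  Any metric extending \<open>d\<close> is bounded by \<open>hat_dist E d\<close> and is therefore
  1-Lipschitz for \<open>ddot_dist E d\<close>. Near a non-isolated pair \<open>s\<close> there is a pair \<open>t\<close> that is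
  closer to \<open>s\<close> than half the distance between two elements \<open>a\<close>, \<open>b\<close> of \<open>F s\<close>. Two choices
  of \<open>r\<close> that agree at \<open>t\<close> and take the values \<open>a\<close> and \<open>b\<close> at \<open>s\<close> cannot both give a metric.
\<close>

lemma graph_path_rev:
  fixes d :: "'a set \<Rightarrow> real"
  assumes "graph_path E x y n p"
  shows "graph_path E y x n (\<lambda>i. p (n - i))"
    and "(\<Sum>i=1..n. d {p (n - (i - 1)), p (n - i)}) = (\<Sum>i=1..n. d {p (i - 1), p i})"
proof -
  \<comment> \<open>Step \<open>i\<close> of the reversed path is step \<open>Suc n - i\<close> of
    \<open>p\<close>. The range starts at 1, so the truncated subtraction is harmless, and this
    reflection of \<open>{1..n}\<close> also reindexes the sum.\<close>
  have *: "{p (n - (i - 1)), p (n - i)} = {p (Suc n - i - 1), p (Suc n - i)}"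
    if "i \<in> {1..n}" for i
    using that by (auto simp: Suc_diff_le)
  show "graph_path E y x n (\<lambda>i. p (n - i))"
    unfolding graph_path_def
  proof (intro conjI ballI)
    fix i assume i: "i \<in> {1..n}"
    then have "Suc n - i \<in> {1..n}" by auto
    then show "{p (n - (i - 1)), p (n - i)} \<in> E"
      using assms *[OF i] unfolding graph_path_def by metis
  qed (use assms in \<open>auto simp: graph_path_def\<close>)
  show "(\<Sum>i=1..n. d {p (n - (i - 1)), p (n - i)}) = (\<Sum>i=1..n. d {p (i - 1), p i})"
    by (rule sum.reindex_bij_witness[of _ "\<lambda>i. Suc n - i" "\<lambda>i. Suc n - i"]) (use * in auto)
qed

lemma graph_path_append:
  fixes d :: "'a set \<Rightarrow> real"
  assumes p: "graph_path E x y m p" and q: "graph_path E y z n q"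
  defines "r \<equiv> \<lambda>i. if i \<le> m then p i else q (i - m)"
  shows "graph_path E x z (m + n) r"
    and "(\<Sum>i=1..m+n. d {r (i - 1), r i})
      = (\<Sum>i=1..m. d {p (i - 1), p i}) + (\<Sum>i=1..n. d {q (i - 1), q i})"
proof -
  have left: "{r (i - 1), r i} = {p (i - 1), p i}" if "i \<in> {1..m}" for i
    using that by (auto simp: r_def)
  \<comment> \<open>At \<open>i = 0\<close> the definition of \<open>r\<close> selects
    \<open>p m\<close>, and this is \<open>q 0\<close> because both are the junction
    \<open>y\<close>.\<close>
  have r: "r (i + m) = q i" for i
    using p q by (auto simp: r_def graph_path_def)
  have right: "{r (i + m - 1), r (i + m)} = {q (i - 1), q i}" if "i \<in> {1..n}" for i
    using r[of i] r[of "i - 1"] that by simp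
  show "graph_path E x z (m + n) r"
    unfolding graph_path_def
  proof (intro conjI ballI)
    show "r 0 = x" "r (m + n) = z"
      using p q r[of n] by (auto simp: r_def graph_path_def add.commute)
    fix i assume i: "i \<in> {1..m+n}"
    show "{r (i - 1), r i} \<in> E"
    proof (cases "i \<le> m")
      case True
      then show ?thesis
        using i left[of i] p by (simp add: graph_path_def)
    next
      case False
      then have "i - m \<in> {1..n}" "i = (i - m) + m" using i by auto
      then show ?thesis
        using right[of "i - m"] q unfolding graph_path_def by metis
    qed
  qed
  have "(\<Sum>i=1..m+n. d {r (i - 1), r i})
      = (\<Sum>i=1..m. d {r (i - 1), r i}) + (\<Sum>i=1+m..n+m. d {r (i - 1), r i})"
    using sum.ub_add_nat[of 1 m "\<lambda>i. d {r (i - 1), r i}" n] by (simp add: add.commute)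
  also have "\<dots> = (\<Sum>i=1..m. d {r (i - 1), r i}) + (\<Sum>i=1..n. d {r (i + m - 1), r (i + m)})"
    by (simp only: sum.shift_bounds_cl_nat_ivl)
  also have "\<dots> = (\<Sum>i=1..m. d {p (i - 1), p i}) + (\<Sum>i=1..n. d {q (i - 1), q i})"
    using left right by (intro arg_cong2[where f = "(+)"] sum.cong) auto
  finally show "(\<Sum>i=1..m+n. d {r (i - 1), r i})
      = (\<Sum>i=1..m. d {p (i - 1), p i}) + (\<Sum>i=1..n. d {q (i - 1), q i})" .
qed

text \<open>Nonnegative weights bound all path lengths below by 0, so the real \<open>Inf\<close> is
  a genuine lower bound.\<close>

lemma hat_dist_le:
  assumes "\<forall>e\<in>E. 0 \<le> d e" and "graph_path E x y n p"
  shows "hat_dist E d x y \<le> (\<Sum>i=1..n. d {p (i - 1), p i})"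
  unfolding hat_dist_def
proof (rule cInf_lower)
  show "bdd_below {(\<Sum>i=1..n. d {p (i - 1), p i}) | n p. graph_path E x y n p}"
    using assms(1) by (intro bdd_belowI[of _ 0]) (auto simp: graph_path_def intro!: sum_nonneg)
qed (use assms(2) in auto)

text \<open>Some path must exist, since \<open>Inf {}\<close> is an unspecified real.\<close>

lemma hat_dist_greatest:
  assumes "\<exists>n p. graph_path E x y n p"
    and "\<And>n p. graph_path E x y n p \<Longrightarrow> c \<le> (\<Sum>i=1..n. d {p (i - 1), p i})"
  shows "c \<le> hat_dist E d x y"
  unfolding hat_dist_def by (rule cInf_greatest) (use assms in auto)

text \<open>A path in \<open>E\<close> survives in \<open>E'\<close> and gets no longer there. This
  serves to compare \<open>d\<close> with its extension to the complete graph.\<close>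

lemma hat_dist_mono:
  assumes "E \<subseteq> E'" and "\<forall>e\<in>E. d' e \<le> d e" and "\<forall>e\<in>E'. 0 \<le> d' e"
    and "\<exists>n p. graph_path E x y n p"
  shows "hat_dist E' d' x y \<le> hat_dist E d x y"
proof (rule hat_dist_greatest[OF assms(4)])
  fix n p assume p: "graph_path E x y n p"
  then have "graph_path E' x y n p"
    using assms(1) by (auto simp: graph_path_def)
  then have "hat_dist E' d' x y \<le> (\<Sum>i=1..n. d' {p (i - 1), p i})"
    by (rule hat_dist_le[OF assms(3)])
  also have "\<dots> \<le> (\<Sum>i=1..n. d {p (i - 1), p i})"
    using p assms(2) by (intro sum_mono) (auto simp: graph_path_def)
  finally show "hat_dist E' d' x y \<le> (\<Sum>i=1..n. d {p (i - 1), p i})" .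
qed

lemma hat_dist_triangle:
  assumes nn: "\<forall>e\<in>E. 0 \<le> d e"
    and xy: "\<exists>n p. graph_path E x y n p" and yz: "\<exists>n p. graph_path E y z n p"
  shows "hat_dist E d x z \<le> hat_dist E d x y + hat_dist E d y z"
proof -
  \<comment> \<open>The two infima on the right are handled one at a time: each is isolated on one
    side, so that it suffices to bound the length of a single path.\<close>
  have "hat_dist E d x z - hat_dist E d y z \<le> hat_dist E d x y"
  proof (rule hat_dist_greatest[OF xy])
    fix m p assume p: "graph_path E x y m p"
    have "hat_dist E d x z - (\<Sum>i=1..m. d {p (i - 1), p i}) \<le> hat_dist E d y z"
    proof (rule hat_dist_greatest[OF yz])
      fix n q assume q: "graph_path E y z n q"
      show "hat_dist E d x z - (\<Sum>i=1..m. d {p (i - 1), p i}) \<le> (\<Sum>i=1..n. d {q (i - 1), q i})"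
        using hat_dist_le[OF nn graph_path_append(1)[OF p q]]
        unfolding graph_path_append(2)[OF p q] by linarith
    qed
    then show "hat_dist E d x z - hat_dist E d y z \<le> (\<Sum>i=1..m. d {p (i - 1), p i})"
      by linarith
  qed
  then show ?thesis by simp
qed

lemma hat_dist_commute_le:
  assumes nn: "\<forall>e\<in>E. 0 \<le> d e" and xy: "\<exists>n p. graph_path E x y n p"
  shows "hat_dist E d y x \<le> hat_dist E d x y"
proof (rule hat_dist_greatest[OF xy])
  fix n p assume p: "graph_path E x y n p"
  show "hat_dist E d y x \<le> (\<Sum>i=1..n. d {p (i - 1), p i})"
    using hat_dist_le[OF nn graph_path_rev(1)[OF p]] unfolding graph_path_rev(2)[OF p] .
qed

lemma connected_graph_path:
  assumes "connected_graph E" "x \<in> \<Union>E" "y \<in> \<Union>E"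
  shows "\<exists>n p. graph_path E x y n p"
  using bspec[OF bspec[OF conjunct2[OF assms(1)[unfolded connected_graph_def]] assms(2)] assms(3)] .

text \<open>The detour from \<open>x\<close> through \<open>u\<close> and \<open>v\<close> to
  \<open>y\<close> bounds \<open>hat_dist E d x y\<close>, and on edges \<open>d\<close> coincides
  with \<open>hat_dist\<close>.\<close>

lemma graph_pseudometric_diff_le:
  assumes gp: "graph_pseudometric E d"
    and xy: "{x, y} \<in> E" and uv: "{u, v} \<in> E"
  shows "d {x, y} \<le> d {u, v} + (hat_dist E d x u + hat_dist E d y v)"
proof -
  have nn: "\<forall>e\<in>E. 0 \<le> d e" and conn: "connected_graph E"
    using gp by (simp_all add: graph_pseudometric_def)
  have "{x, y} \<union> {u, v} \<subseteq> \<Union>E"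
    using xy uv by (intro Un_least Union_upper)
  then have V: "x \<in> \<Union>E" "y \<in> \<Union>E" "u \<in> \<Union>E" "v \<in> \<Union>E"
    by (simp_all only: Un_subset_iff insert_subset)
  note path = connected_graph_path[OF conn]
  have "hat_dist E d x y \<le> hat_dist E d x u + hat_dist E d u y"
    by (intro hat_dist_triangle nn path V)
  moreover have "hat_dist E d u y \<le> hat_dist E d u v + hat_dist E d v y"
    by (intro hat_dist_triangle nn path V)
  moreover have "hat_dist E d v y \<le> hat_dist E d y v"
    by (intro hat_dist_commute_le nn path V)
  moreover have "d {x, y} = hat_dist E d x y" "d {u, v} = hat_dist E d u v"
    using gp xy uv by (simp_all add: graph_pseudometric_def)
  ultimately show ?thesis by linarith
qed

text \<open>The detour estimate is applied in the complete graph, where the extension is a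
  pseudometric. Its correction terms are distances of the extension; paths in \<open>E\<close> show
  that they are at most those of \<open>d\<close>.\<close>

lemma full_metric_ddot_Lipschitz:
  assumes conn: "connected_graph E"
    and full: "full_metric (pairs (\<Union>E)) (extend_by E d r)"
    and e: "e \<in> pairs (\<Union>E)" and f: "f \<in> pairs (\<Union>E)"
  shows "\<bar>extend_by E d r e - extend_by E d r f\<bar> \<le> ddot_dist E d e f"
proof -
  let ?P = "pairs (\<Union>E)" and ?D = "extend_by E d r"
  have gp: "graph_pseudometric ?P ?D"
    using full by (simp add: full_metric_def graph_metric_def)
  then have nnP: "\<forall>e\<in>?P. 0 \<le> ?D e"
    by (simp add: graph_pseudometric_def)
  have sub: "E \<subseteq> ?P"
    using conn by (auto simp: connected_graph_def simple_graph_def pairs_def)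
  have DE: "\<forall>e\<in>E. ?D e = d e"
    by (simp add: extend_by_def)
  have nn: "\<forall>e\<in>E. 0 \<le> d e"
    using nnP sub DE by fastforce
  note path = connected_graph_path[OF conn]
  obtain x y u v where xy: "e = {x, y}" and uv: "f = {u, v}"
    using e f by (auto simp: pairs_def card_2_iff)
  have V: "x \<in> \<Union>E" "y \<in> \<Union>E" "u \<in> \<Union>E" "v \<in> \<Union>E"
    using e f by (simp_all only: xy uv pairs_def mem_Collect_eq insert_subset)
  have le_hat: "hat_dist ?P ?D a b \<le> hat_dist E d a b" if "a \<in> \<Union>E" "b \<in> \<Union>E" for a b
    by (intro hat_dist_mono sub nnP path that) (simp add: DE)
  have le: "?D {a, b} \<le> ?D {a', b'} + (hat_dist E d a a' + hat_dist E d b b')"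
    if "{a, b} \<in> ?P" "{a', b'} \<in> ?P" and "a \<in> \<Union>E" "b \<in> \<Union>E" "a' \<in> \<Union>E" "b' \<in> \<Union>E"
    for a b a' b'
    using graph_pseudometric_diff_le[OF gp that(1,2)] le_hat[OF that(3,5)] le_hat[OF that(4,6)]
    by linarith
  have comm: "hat_dist E d b a = hat_dist E d a b" if "a \<in> \<Union>E" "b \<in> \<Union>E" for a b
    by (intro antisym hat_dist_commute_le nn path that)
  have swap: "{y, x} = {x, y}" "{v, u} = {u, v}"
    by (simp_all add: insert_commute)
  have P: "{x, y} \<in> ?P" "{u, v} \<in> ?P"
    using e f by (simp_all only: xy uv)
  \<comment> \<open>The absolute value calls for both directions, and the minimum in
    \<open>ddot_dist_pair\<close> for both matchings of the endpoints: four inequalities in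
    all.\<close>
  have "?D {x, y} \<le> ?D {u, v} + (hat_dist E d x u + hat_dist E d y v)"
    by (intro le P V)
  moreover have "?D {x, y} \<le> ?D {u, v} + (hat_dist E d x v + hat_dist E d y u)"
    using le[of x y v u] P V by (simp only: swap)
  moreover have "?D {u, v} \<le> ?D {x, y} + (hat_dist E d x u + hat_dist E d y v)"
    using le[OF P(2,1) V(3,4,1,2)] by (simp only: comm V)
  moreover have "?D {u, v} \<le> ?D {x, y} + (hat_dist E d x v + hat_dist E d y u)"
    using le[of u v y x] P V by (simp only: swap comm[OF V(1,4)] comm[OF V(2,3)] add.commute)
  ultimately show ?thesis
    unfolding xy uv ddot_dist_pair by linarith
qed

lemma not_discrete_subspaceE:
  assumes "\<not> discrete_subspace \<rho> S"
  obtains s where "s \<in> S" "\<forall>\<epsilon>>0. \<exists>t\<in>S. t \<noteq> s \<and> \<rho> s t < \<epsilon>"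
  using assms unfolding discrete_subspace_def by blast

theorem theorem1p9:
  fixes E :: "'a set set" and d :: "'a set \<Rightarrow> real" and F :: "'a set \<Rightarrow> real set"
  assumes "graph_metric E d"
    and "floppy E d"
    and "\<not> discrete_subspace (ddot_dist E d) (pairs (\<Union>E) - E)"
    and "\<And>e. e \<in> pairs (\<Union>E) - E \<Longrightarrow> \<exists>a\<in>F e. \<exists>b\<in>F e. a \<noteq> b"
  shows "\<exists>r \<in> Pi\<^sub>E (pairs (\<Union>E) - E) F. \<not> full_metric (pairs (\<Union>E)) (extend_by E d r)"
proof (rule ccontr)
  let ?S = "pairs (\<Union>E) - E"
  assume "\<not> ?thesis"
  then have full: "full_metric (pairs (\<Union>E)) (extend_by E d r)" if "r \<in> Pi\<^sub>E ?S F" for r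
    using that by blast
  have conn: "connected_graph E"
    using assms(1) by (simp add: graph_metric_def graph_pseudometric_def)
  obtain s where s: "s \<in> ?S"
    and near: "\<forall>\<epsilon>>0. \<exists>t\<in>?S. t \<noteq> s \<and> ddot_dist E d s t < \<epsilon>"
    using not_discrete_subspaceE[OF assms(3)] .
  obtain a b where ab: "a \<in> F s" "b \<in> F s" "a \<noteq> b"
    using assms(4)[OF s] by blast
  \<comment> \<open>Both \<open>a\<close> and \<open>b\<close> will lie within
    \<open>ddot_dist E d s t\<close> of the same number \<open>r t\<close>, which forces their
    distance to be at most twice this bound; hence the half.\<close>
  obtain t where t: "t \<in> ?S" "t \<noteq> s" "ddot_dist E d s t < \<bar>a - b\<bar> / 2"
    using near[rule_format, of "\<bar>a - b\<bar> / 2"] ab(3)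
    by (metis half_gt_zero zero_less_abs_iff right_minus_eq)
  obtain r where r: "r \<in> Pi\<^sub>E ?S F"
  proof -
    have "\<not> (\<exists>e\<in>?S. F e = {})"
      using assms(4) by (metis empty_iff)
    then show ?thesis
      using that unfolding PiE_eq_empty_iff[symmetric] ex_in_conv[symmetric] not_not by (elim exE)
  qed
  have "\<bar>c - r t\<bar> \<le> ddot_dist E d s t" if "c \<in> F s" for c
  proof -
    \<comment> \<open>As \<open>s\<close> is already an index, the update stays in the same product;
      as \<open>t\<close> differs from \<open>s\<close>, it keeps the value
      \<open>r t\<close>.\<close>
    have "r(s := c) \<in> Pi\<^sub>E ?S F"
      using PiE_fun_upd[where T = F, OF that r] by (simp only: insert_absorb[OF s])
    from full_metric_ddot_Lipschitz[OF conn full[OF this], of s t] show ?thesis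
      using s t by (simp add: extend_by_def)
  qed
  then have "\<bar>a - r t\<bar> \<le> ddot_dist E d s t" "\<bar>b - r t\<bar> \<le> ddot_dist E d s t"
    using ab by blast+
  moreover have "\<bar>a - b\<bar> \<le> \<bar>a - r t\<bar> + \<bar>b - r t\<bar>"
    using abs_triangle_ineq4[of "a - r t" "b - r t"] by simp
  ultimately show False
    using t(3) by (simp add: field_simps)
qed

end
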